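(* Let $\pi_A,\pi_B$ be $\mathbb{B}$-interpretations (not necessarily model-defining) over a finite relational vocabulary $\tau$, let $\bar a\in A^n$, $\bar b\in B^n$ and $m\in\mathbb{N}$. The following are equivalent: (1) Duplicator has a winning strategy in $G^{\le}_m(\pi_A,\bar a,\pi_B,\bar b)$; (2) $\pi_B[\![\chi^m_{\pi_A,\bar a}(\bar b)]\!]=1$; (3) $(\pi_A,\bar a)\preceq_m(\pi_B,\bar b)$.
   Context: $\mathbb{B}=(\{0,1\},\vee,\wedge,0,1)$ with order $0\le1$. A $\mathbb{B}$-interpretation with universe $A$ is any map $\pi$ from the literals $R\bar a,\neg R\bar a$ ($R\in\tau$, $\bar a$ from $A$) to $\{0,1\}$ (no constraint relating $\pi(R\bar a)$ and $\pi(\neg R\bar a)$). Formulae in negation normal form are evaluated with equalities/inequalities by truth value, literals by $\pi$, $\vee,\exists$ by disjunction over the universe, $\wedge,\forall$ by conjunction. $(\pi_A,\bar a)\preceq_m(\pi_B,\bar b)$ means $\pi_A[\![\varphi(\bar a)]\!]\le\pi_B[\![\varphi(\bar b)]\!]$ for all formulae $\varphi(\bar x)$ of quantifier rank at most $m$. The one-sided game $G^{\le}_m(\pi_A,\bar a,\pi_B,\bar b)$: in each of $m$ rounds Spoiler picks an element of $A$ or $B$ and Duplicator one of the other universe; with final tuples $\bar a',\bar b'$ of length $k$, Duplicator wins iff $a'_i=a'_j\Leftrightarrow b'_i=b'_j$ for all $i,j$ and $\pi_A(L(\bar a'))\le\pi_B(L(\bar b'))$ for every literal $L(x_1,\dots,x_k)$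 over $\tau$. Characteristic formulae: $\varphi^=_{\bar a}(\bar x)$ is the conjunction of all $x_i=x_j$ with $a_i=a_j$ and $x_i\ne x_j$ with $a_i\ne a_j$; $\chi^0_{\pi_A,\bar a}(\bar x)=\varphi^=_{\bar a}(\bar x)\wedge\bigwedge\{L(\bar x):L$ a $\tau$-literal in $x_1,\dots,x_n$ with $\pi_A(L(\bar a))=1\}$; $\chi^{m+1}_{\pi_A,\bar a}(\bar x)=\bigwedge_{a\in A}\exists x\,\chi^m_{\pi_A,\bar a a}(\bar x,x)\wedge\forall x\bigvee_{a\in A}\chi^m_{\pi_A,\bar a a}(\bar x,x)$ (the conjunction and disjunction range over the finitely many distinct formulae obtained). *)

theory Defs
  imports Main
begin

text \<open>A relational vocabulary is a partial map sending each of its relation symbols to its arity;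
  it is finite iff its domain is finite.\<close>

type_synonym 'r vocabulary = "'r \<rightharpoonup> nat"

datatype (dead 'r, lit_args: 'v) literal = Pos 'r "'v list" | Neg 'r "'v list"
  for map: map_literal

fun literal_over :: "'r vocabulary \<Rightarrow> ('r, 'v) literal \<Rightarrow> bool" where
  "literal_over \<tau> (Pos R ts) \<longleftrightarrow> \<tau> R = Some (length ts)"
| "literal_over \<tau> (Neg R ts) \<longleftrightarrow> \<tau> R = Some (length ts)"

text \<open>The semiring of truth values is \<^typ>\<open>bool\<close>, whose library order is
  \<^term>\<open>False \<le> True\<close>.  The valuation is an arbitrary function on literals: nothing relates the
  values of \<^term>\<open>Pos R as\<close> and \<^term>\<open>Neg R as\<close>.  Only its values on literals over the vocabulary
  with entries in the universe are ever used.\<close>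

record ('r, 'a) interp =
  universe :: "'a set"
  val :: "('r, 'a) literal \<Rightarrow> bool"

text \<open>Formulae in negation normal form; the variables are \<open>x\<^sub>0, x\<^sub>1, \<dots>\<close>, given by their indices.
  \<open>Top\<close> and \<open>Bot\<close> serve as the empty conjunction and disjunction.\<close>

datatype 'r formula =
    Top
  | Bot
  | Eq nat nat
  | Neq nat nat
  | Lit "('r, nat) literal"
  | Or "'r formula" "'r formula"
  | And "'r formula" "'r formula"
  | Ex nat "'r formula"
  | All nat "'r formula"

fun formula_over :: "'r vocabulary \<Rightarrow> 'r formula \<Rightarrow> bool" where
  "formula_over \<tau> (Lit L) \<longleftrightarrow> literal_over \<tau> L"
| "formula_over \<tau> (Or \<phi> \<psi>) \<longleftrightarrow> formula_over \<tau> \<phi> \<and> formula_over \<tau> \<psi>"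
| "formula_over \<tau> (And \<phi> \<psi>) \<longleftrightarrow> formula_over \<tau> \<phi> \<and> formula_over \<tau> \<psi>"
| "formula_over \<tau> (Ex x \<phi>) \<longleftrightarrow> formula_over \<tau> \<phi>"
| "formula_over \<tau> (All x \<phi>) \<longleftrightarrow> formula_over \<tau> \<phi>"
| "formula_over \<tau> _ \<longleftrightarrow> True"

fun free_vars :: "'r formula \<Rightarrow> nat set" where
  "free_vars Top = {}"
| "free_vars Bot = {}"
| "free_vars (Eq x y) = {x, y}"
| "free_vars (Neq x y) = {x, y}"
| "free_vars (Lit L) = lit_args L"
| "free_vars (Or \<phi> \<psi>) = free_vars \<phi> \<union> free_vars \<psi>"
| "free_vars (And \<phi> \<psi>) = free_vars \<phi> \<union> free_vars \<psi>"
| "free_vars (Ex x \<phi>) = free_vars \<phi> - {x}"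
| "free_vars (All x \<phi>) = free_vars \<phi> - {x}"

fun quantifier_rank :: "'r formula \<Rightarrow> nat" where
  "quantifier_rank (Or \<phi> \<psi>) = max (quantifier_rank \<phi>) (quantifier_rank \<psi>)"
| "quantifier_rank (And \<phi> \<psi>) = max (quantifier_rank \<phi>) (quantifier_rank \<psi>)"
| "quantifier_rank (Ex x \<phi>) = Suc (quantifier_rank \<phi>)"
| "quantifier_rank (All x \<phi>) = Suc (quantifier_rank \<phi>)"
| "quantifier_rank _ = 0"

fun eval :: "('r, 'a) interp \<Rightarrow> (nat \<Rightarrow> 'a) \<Rightarrow> 'r formula \<Rightarrow> bool" where
  "eval \<pi> s Top \<longleftrightarrow> True"
| "eval \<pi> s Bot \<longleftrightarrow> False"
| "eval \<pi> s (Eq x y) \<longleftrightarrow> s x = s y"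
| "eval \<pi> s (Neq x y) \<longleftrightarrow> s x \<noteq> s y"
| "eval \<pi> s (Lit L) \<longleftrightarrow> val \<pi> (map_literal s L)"
| "eval \<pi> s (Or \<phi> \<psi>) \<longleftrightarrow> eval \<pi> s \<phi> \<or> eval \<pi> s \<psi>"
| "eval \<pi> s (And \<phi> \<psi>) \<longleftrightarrow> eval \<pi> s \<phi> \<and> eval \<pi> s \<psi>"
| "eval \<pi> s (Ex x \<phi>) \<longleftrightarrow> (\<exists>a\<in>universe \<pi>. eval \<pi> (s(x := a)) \<phi>)"
| "eval \<pi> s (All x \<phi>) \<longleftrightarrow> (\<forall>a\<in>universe \<pi>. eval \<pi> (s(x := a)) \<phi>)"

text \<open>The value of \<open>\<phi>(a\<^sub>0, \<dots>, a\<^bsub>n-1\<^esub>)\<close>.  It is only used when the free variables of \<open>\<phi>\<close> have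
  indices below the length of the tuple, so the unspecified entries of \<^term>\<open>(!)\<close> do not matter.\<close>

definition eval_at :: "('r, 'a) interp \<Rightarrow> 'r formula \<Rightarrow> 'a list \<Rightarrow> bool" where
  "eval_at \<pi> \<phi> as = eval \<pi> (\<lambda>i. as ! i) \<phi>"

definition preceq :: "'r vocabulary \<Rightarrow> nat \<Rightarrow> ('r, 'a) interp \<Rightarrow> 'a list \<Rightarrow>
    ('r, 'b) interp \<Rightarrow> 'b list \<Rightarrow> bool" where
  "preceq \<tau> m \<pi>A as \<pi>B bs \<longleftrightarrow>
     (\<forall>\<phi>. formula_over \<tau> \<phi> \<and> free_vars \<phi> \<subseteq> {..<length as} \<and> quantifier_rank \<phi> \<le> m \<longrightarrow>
          eval_at \<pi>A \<phi> as \<le> eval_at \<pi>B \<phi> bs)"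

definition final_win :: "'r vocabulary \<Rightarrow> ('r, 'a) interp \<Rightarrow> 'a list \<Rightarrow>
    ('r, 'b) interp \<Rightarrow> 'b list \<Rightarrow> bool" where
  "final_win \<tau> \<pi>A as \<pi>B bs \<longleftrightarrow>
     (\<forall>i<length as. \<forall>j<length as. as ! i = as ! j \<longleftrightarrow> bs ! i = bs ! j) \<and>
     (\<forall>L. literal_over \<tau> L \<and> lit_args L \<subseteq> {..<length as} \<longrightarrow>
          val \<pi>A (map_literal (\<lambda>i. as ! i) L) \<le> val \<pi>B (map_literal (\<lambda>i. bs ! i) L))"

text \<open>A move of Spoiler is \<^term>\<open>Inl a\<close> (an element of the first universe) or \<^term>\<open>Inr b\<close> (an
  element of the second).  A strategy of Duplicator consists of two functions \<open>f\<close> and \<open>g\<close>: if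
  \<open>h\<close> is the list of the previous moves of Spoiler (which together with the strategy determines
  the previous answers of Duplicator), then \<^term>\<open>f h a\<close> is the answer to \<^term>\<open>Inl a\<close> and
  \<^term>\<open>g h b\<close> is the answer to \<^term>\<open>Inr b\<close>.  The function below gives the pairs of
  elements chosen in the successive rounds when Spoiler makes the moves \<open>ms\<close>.\<close>

definition play :: "(('a + 'b) list \<Rightarrow> 'a \<Rightarrow> 'b) \<Rightarrow> (('a + 'b) list \<Rightarrow> 'b \<Rightarrow> 'a) \<Rightarrow>
    ('a + 'b) list \<Rightarrow> ('a \<times> 'b) list" where
  "play f g ms =
     map (\<lambda>i. case ms ! i of
                Inl a \<Rightarrow> (a, f (take i ms) a)
              | Inr b \<Rightarrow> (g (take i ms) b, b))
       [0..<length ms]"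

definition winning_strategy :: "'r vocabulary \<Rightarrow> nat \<Rightarrow> ('r, 'a) interp \<Rightarrow> 'a list \<Rightarrow>
    ('r, 'b) interp \<Rightarrow> 'b list \<Rightarrow>
    (('a + 'b) list \<Rightarrow> 'a \<Rightarrow> 'b) \<Rightarrow> (('a + 'b) list \<Rightarrow> 'b \<Rightarrow> 'a) \<Rightarrow> bool" where
  "winning_strategy \<tau> m \<pi>A as \<pi>B bs f g \<longleftrightarrow>
     (\<forall>ms. length ms = m \<and> set ms \<subseteq> universe \<pi>A <+> universe \<pi>B \<longrightarrow>
        set (play f g ms) \<subseteq> universe \<pi>A \<times> universe \<pi>B \<and>
        final_win \<tau> \<pi>A (as @ map fst (play f g ms)) \<pi>B (bs @ map snd (play f g ms)))"

definition duplicator_wins :: "'r vocabulary \<Rightarrow> nat \<Rightarrow> ('r, 'a) interp \<Rightarrow> 'a list \<Rightarrow>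
    ('r, 'b) interp \<Rightarrow> 'b list \<Rightarrow> bool" where
  "duplicator_wins \<tau> m \<pi>A as \<pi>B bs \<longleftrightarrow> (\<exists>f g. winning_strategy \<tau> m \<pi>A as \<pi>B bs f g)"

text \<open>Conjunction and disjunction of a finite set of formulae, in some arbitrary order without
  repetitions.  They are meaningful for finite sets only; all sets to which the
  characteristic formulae apply them are finite when the vocabulary is finite, even over an
  infinite universe.\<close>

definition enum_set :: "'c set \<Rightarrow> 'c list" where
  "enum_set S = (SOME xs. set xs = S \<and> distinct xs)"

definition Conj :: "'r formula set \<Rightarrow> 'r formula" where
  "Conj S = foldr And (enum_set S) Top"

definition Disj :: "'r formula set \<Rightarrow> 'r formula" where
  "Disj S = foldr Or (enum_set S) Bot"

definition eq_type :: "'a list \<Rightarrow> 'r formula" where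
  "eq_type as =
     Conj ({Eq i j | i j. i < length as \<and> j < length as \<and> as ! i = as ! j} \<union>
           {Neq i j | i j. i < length as \<and> j < length as \<and> as ! i \<noteq> as ! j})"

text \<open>In the step, the new variable is the one following those of the tuple, so that it is
  evaluated to the entry appended to the tuple.\<close>

fun char_formula :: "'r vocabulary \<Rightarrow> ('r, 'a) interp \<Rightarrow> nat \<Rightarrow> 'a list \<Rightarrow> 'r formula" where
  "char_formula \<tau> \<pi> 0 as =
     And (eq_type as)
         (Conj {Lit L | L. literal_over \<tau> L \<and> lit_args L \<subseteq> {..<length as} \<and>
                           val \<pi> (map_literal (\<lambda>i. as ! i) L)})"
| "char_formula \<tau> \<pi> (Suc m) as =
     And (Conj {Ex (length as) (char_formula \<tau> \<pi> m (as @ [a])) | a. a \<in> universe \<pi>})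
         (All (length as) (Disj {char_formula \<tau> \<pi> m (as @ [a]) | a. a \<in> universe \<pi>}))"

end

theory Submission
  imports Defs
begin

text \<open>The game is replaced by its back-and-forth recursion, in which Duplicator's answer to the
  next move of Spoiler is chosen locally; a strategy is assembled from the answer to the first
  move and the strategies for the remaining rounds.  The characteristic formula spells out this
  recursion, and a back-and-forth system preserves the truth of formulae by induction on the
  formula.  Conversely, every tuple satisfies its own characteristic formula, because
  back-and-forth is reflexive, and this formula is among those compared in rank \<open>m\<close>.\<close>

section \<open>Finite conjunctions and disjunctions\<close>

lemma set_enum_set: "finite S \<Longrightarrow> set (enum_set S) = S"
  unfolding enum_set_def using someI_ex[OF finite_distinct_list] by blast

lemma eval_Conj: "finite S \<Longrightarrow> eval \<pi> s (Conj S) \<longleftrightarrow> (\<forall>\<phi>\<in>S. eval \<pi> s \<phi>)"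
proof -
  have "eval \<pi> s (foldr And xs Top) \<longleftrightarrow> (\<forall>\<phi>\<in>set xs. eval \<pi> s \<phi>)" for xs
    by (induction xs) auto
  then show "finite S \<Longrightarrow> ?thesis" by (simp add: Conj_def set_enum_set)
qed

lemma eval_Disj: "finite S \<Longrightarrow> eval \<pi> s (Disj S) \<longleftrightarrow> (\<exists>\<phi>\<in>S. eval \<pi> s \<phi>)"
proof -
  have "eval \<pi> s (foldr Or xs Bot) \<longleftrightarrow> (\<exists>\<phi>\<in>set xs. eval \<pi> s \<phi>)" for xs
    by (induction xs) auto
  then show "finite S \<Longrightarrow> ?thesis" by (simp add: Disj_def set_enum_set)
qed

text \<open>For tuples of length \<open>n\<close>, exactly the formulae over which
  \<open>preceq\<close> of rank \<open>m\<close> quantifies.\<close>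

definition formula_class :: "'r vocabulary \<Rightarrow> nat \<Rightarrow> nat \<Rightarrow> 'r formula set" where
  "formula_class \<tau> n m =
     {\<phi>. formula_over \<tau> \<phi> \<and> free_vars \<phi> \<subseteq> {..<n} \<and> quantifier_rank \<phi> \<le> m}"

lemma Conj_in_formula_class:
  assumes "finite S" and "S \<subseteq> formula_class \<tau> n m"
  shows "Conj S \<in> formula_class \<tau> n m"
proof -
  have "set xs \<subseteq> formula_class \<tau> n m \<Longrightarrow> foldr And xs Top \<in> formula_class \<tau> n m" for xs
    by (induction xs) (auto simp: formula_class_def)
  then show ?thesis using assms by (simp add: Conj_def set_enum_set)
qed

lemma Disj_in_formula_class:
  assumes "finite S" and "S \<subseteq> formula_class \<tau> n m"
  shows "Disj S \<in> formula_class \<tau> n m"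
proof -
  have "set xs \<subseteq> formula_class \<tau> n m \<Longrightarrow> foldr Or xs Bot \<in> formula_class \<tau> n m" for xs
    by (induction xs) (auto simp: formula_class_def)
  then show ?thesis using assms by (simp add: Disj_def set_enum_set)
qed

section \<open>Finiteness and syntactic bounds for characteristic formulae\<close>

lemma finite_literals:
  assumes "finite (dom \<tau>)" and "finite V"
  shows "finite {L. literal_over \<tau> L \<and> lit_args L \<subseteq> V}"
proof (rule finite_subset)
  let ?T = "\<lambda>R. {ts. set ts \<subseteq> V \<and> length ts = the (\<tau> R)}"
  show "{L. literal_over \<tau> L \<and> lit_args L \<subseteq> V} \<subseteq> (\<Union>R\<in>dom \<tau>. Pos R ` ?T R \<union> Neg R ` ?T R)"
  proof
    fix L assume "L \<in> {L. literal_over \<tau> L \<and> lit_args L \<subseteq> V}"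
    then show "L \<in> (\<Union>R\<in>dom \<tau>. Pos R ` ?T R \<union> Neg R ` ?T R)"
      by (cases L) force+
  qed
  show "finite (\<Union>R\<in>dom \<tau>. Pos R ` ?T R \<union> Neg R ` ?T R)"
    using assms by (simp add: finite_lists_length_eq)
qed

lemma finite_eqs:
  "finite ({Eq i j | i j. i < n \<and> j < n \<and> P i j} \<union> {Neq i j | i j. i < n \<and> j < n \<and> Q i j})"
  by (rule finite_subset[of _ "case_prod Eq ` ({..<n} \<times> {..<n}) \<union>
        case_prod Neq ` ({..<n} \<times> {..<n})"]) auto

lemma finite_Lits:
  assumes "finite (dom \<tau>)"
  shows "finite {Lit L | L. literal_over \<tau> L \<and> lit_args L \<subseteq> {..<n::nat} \<and> P L}"
  by (rule finite_subset[OF _ finite_imageI[OF finite_literals[OF assms finite_lessThan], of Lit]])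
    auto

text \<open>The universe may be infinite, so the bound comes from the syntax. At rank 0 the formulae
  come from subsets of a finite set of atoms, later from subsets of the finite set of the previous
  rank; \<open>Conj\<close> and \<open>Disj\<close> depend only on the set they are given. The step
  lengthens the tuple, hence the induction for all \<open>n\<close>.\<close>

lemma finite_char_formulas_length:
  assumes "finite (dom \<tau>)"
  shows "finite {char_formula \<tau> \<pi> m as | as. length as = n}"
proof (induction m arbitrary: n)
  case 0
  \<comment> \<open>The dummy conjuncts \<open>True\<close> give these sets the shape of
    \<open>finite_eqs\<close> and \<open>finite_Lits\<close>.\<close>
  let ?E = "{Eq i j | i j. i < n \<and> j < n \<and> True} \<union> {Neq i j | i j. i < n \<and> j < n \<and> True}"
  let ?L = "{Lit L | L. literal_over \<tau> L \<and> lit_args L \<subseteq> {..<n} \<and> True}"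
  have "finite (case_prod And ` (Conj ` Pow ?E \<times> Conj ` Pow ?L))"
    by (intro finite_imageI finite_cartesian_product finite_Pow_iff[THEN iffD2]
        finite_eqs finite_Lits assms)
  moreover have "{char_formula \<tau> \<pi> 0 as | as. length as = n} \<subseteq>
      case_prod And ` (Conj ` Pow ?E \<times> Conj ` Pow ?L)"
  proof
    fix \<chi> assume "\<chi> \<in> {char_formula \<tau> \<pi> 0 as | as. length as = n}"
    then obtain as where \<chi>: "\<chi> = char_formula \<tau> \<pi> 0 as" and n: "n = length as" by blast
    have "eq_type as \<in> Conj ` Pow ?E"
      unfolding eq_type_def n by (intro imageI PowI) blast
    moreover have "Conj {Lit L | L. literal_over \<tau> L \<and> lit_args L \<subseteq> {..<length as} \<and>
        val \<pi> (map_literal (\<lambda>i. as ! i) L)} \<in> Conj ` Pow ?L"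
      unfolding n by (intro imageI PowI) blast
    ultimately show "\<chi> \<in> case_prod And ` (Conj ` Pow ?E \<times> Conj ` Pow ?L)"
      unfolding \<chi> char_formula.simps by (rule pair_imageI[OF SigmaI])
  qed
  ultimately show ?case by (rule finite_subset[rotated])
next
  case (Suc m)
  let ?F = "{char_formula \<tau> \<pi> m as | as. length as = Suc n}"
  let ?G = "(\<lambda>(S, T). And (Conj S) (All n (Disj T))) ` (Pow (Ex n ` ?F) \<times> Pow ?F)"
  have "finite ?G"
    by (intro finite_imageI finite_cartesian_product finite_Pow_iff[THEN iffD2] Suc.IH)
  moreover have "{char_formula \<tau> \<pi> (Suc m) as | as. length as = n} \<subseteq> ?G"
  proof
    fix \<chi> assume "\<chi> \<in> {char_formula \<tau> \<pi> (Suc m) as | as. length as = n}"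
    then obtain as where \<chi>: "\<chi> = char_formula \<tau> \<pi> (Suc m) as" and n: "n = length as" by blast
    have "char_formula \<tau> \<pi> m (as @ [a]) \<in> ?F" for a
      using n by (intro CollectI exI[of _ "as @ [a]"]) simp
    then have "{Ex n (char_formula \<tau> \<pi> m (as @ [a])) | a. a \<in> universe \<pi>} \<in> Pow (Ex n ` ?F)"
      and "{char_formula \<tau> \<pi> m (as @ [a]) | a. a \<in> universe \<pi>} \<in> Pow ?F"
      by (auto simp del: mem_Collect_eq)
    then show "\<chi> \<in> ?G"
      unfolding \<chi> char_formula.simps n[symmetric] by (rule pair_imageI[OF SigmaI])
  qed
  ultimately show ?case by (rule finite_subset[rotated])
qed

lemma finite_char_formulas:
  assumes "finite (dom \<tau>)"
  shows "finite {char_formula \<tau> \<pi> m (as @ [a]) | a. a \<in> universe \<pi>}"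
    and "finite {Ex n (char_formula \<tau> \<pi> m (as @ [a])) | a. a \<in> universe \<pi>}"
proof -
  show fin: "finite {char_formula \<tau> \<pi> m (as @ [a]) | a. a \<in> universe \<pi>}"
    by (rule finite_subset[OF _ finite_char_formulas_length[OF assms, of \<pi> m "Suc (length as)"]])
      fastforce
  show "finite {Ex n (char_formula \<tau> \<pi> m (as @ [a])) | a. a \<in> universe \<pi>}"
    by (rule finite_subset[OF _ finite_imageI[OF fin, of "Ex n"]]) auto
qed

text \<open>This places the characteristic formula among those compared by \<open>preceq\<close>.
  The quantified variable has index \<open>length as\<close>, the largest that can be free in the
  body: binding it brings the free indices back below \<open>length as\<close> and costs one
  rank.\<close>

lemma char_formula_in_formula_class:
  assumes "finite (dom \<tau>)"
  shows "char_formula \<tau> \<pi> m as \<in> formula_class \<tau> (length as) m"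
proof (induction m arbitrary: as)
  case 0
  have "eq_type as \<in> formula_class \<tau> (length as) 0"
    unfolding eq_type_def
    by (rule Conj_in_formula_class[OF finite_eqs]) (auto simp: formula_class_def)
  moreover have "Conj {Lit L | L. literal_over \<tau> L \<and> lit_args L \<subseteq> {..<length as} \<and>
        val \<pi> (map_literal (\<lambda>i. as ! i) L)} \<in> formula_class \<tau> (length as) 0"
    by (rule Conj_in_formula_class[OF finite_Lits[OF assms]]) (auto simp: formula_class_def)
  ultimately show ?case by (simp add: formula_class_def)
next
  case (Suc m)
  let ?n = "length as"
  have step: "char_formula \<tau> \<pi> m (as @ [a]) \<in> formula_class \<tau> (Suc ?n) m" for a
    using Suc.IH[of "as @ [a]"] by simp
  have "Ex ?n \<phi> \<in> formula_class \<tau> ?n (Suc m)" and All: "All ?n \<phi> \<in> formula_class \<tau> ?n (Suc m)"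
    if "\<phi> \<in> formula_class \<tau> (Suc ?n) m" for \<phi>
    using that by (auto simp: formula_class_def lessThan_Suc)
  then have "Conj {Ex ?n (char_formula \<tau> \<pi> m (as @ [a])) | a. a \<in> universe \<pi>}
      \<in> formula_class \<tau> ?n (Suc m)"
    by (intro Conj_in_formula_class finite_char_formulas assms) (auto intro: step)
  moreover have "Disj {char_formula \<tau> \<pi> m (as @ [a]) | a. a \<in> universe \<pi>}
      \<in> formula_class \<tau> (Suc ?n) m"
    by (intro Disj_in_formula_class finite_char_formulas assms) (auto intro: step)
  ultimately show ?case using All by (simp add: formula_class_def)
qed

section \<open>Back-and-forth systems and preservation of formulae\<close>

fun back_forth :: "'r vocabulary \<Rightarrow> ('r, 'a) interp \<Rightarrow> ('r, 'b) interp \<Rightarrow> nat \<Rightarrow>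
    'a list \<Rightarrow> 'b list \<Rightarrow> bool" where
  "back_forth \<tau> \<pi>A \<pi>B 0 as bs \<longleftrightarrow> final_win \<tau> \<pi>A as \<pi>B bs"
| "back_forth \<tau> \<pi>A \<pi>B (Suc m) as bs \<longleftrightarrow>
     (\<forall>a\<in>universe \<pi>A. \<exists>b\<in>universe \<pi>B. back_forth \<tau> \<pi>A \<pi>B m (as @ [a]) (bs @ [b])) \<and>
     (\<forall>b\<in>universe \<pi>B. \<exists>a\<in>universe \<pi>A. back_forth \<tau> \<pi>A \<pi>B m (as @ [a]) (bs @ [b]))"

text \<open>Duplicator copies every move, so each final comparison is between equal things.\<close>

lemma back_forth_refl: "back_forth \<tau> \<pi> \<pi> m as as"
  by (induction m arbitrary: as) (auto simp: final_win_def)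

lemma map_literal_cong:
  "(\<And>x. x \<in> lit_args L \<Longrightarrow> f x = g x) \<Longrightarrow> map_literal f L = map_literal g L"
  by (cases L) auto

lemma literal_over_map: "literal_over \<tau> (map_literal f L) \<longleftrightarrow> literal_over \<tau> L"
  by (cases L) auto

text \<open>Conditions on the shorter tuples mention only positions that appending leaves unchanged;
  equal lengths keep the two sides aligned.\<close>

lemma final_win_prefix:
  assumes "final_win \<tau> \<pi>A (as @ as') \<pi>B (bs @ bs')" and "length as = length bs"
  shows "final_win \<tau> \<pi>A as \<pi>B bs"
  unfolding final_win_def
proof (intro conjI allI impI)
  fix i j assume "i < length as" "j < length as"
  moreover from this have "(as @ as') ! i = (as @ as') ! j \<longleftrightarrow> (bs @ bs') ! i = (bs @ bs') ! j"
    using assms unfolding final_win_def by simp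
  ultimately show "as ! i = as ! j \<longleftrightarrow> bs ! i = bs ! j"
    using assms(2) by (simp add: nth_append)
next
  fix L assume L: "literal_over \<tau> L \<and> lit_args L \<subseteq> {..<length as}"
  then have "val \<pi>A (map_literal (\<lambda>i. (as @ as') ! i) L) \<le>
      val \<pi>B (map_literal (\<lambda>i. (bs @ bs') ! i) L)"
    using assms unfolding final_win_def by fastforce
  moreover have "map_literal (\<lambda>i. (as @ as') ! i) L = map_literal (\<lambda>i. as ! i) L"
    and "map_literal (\<lambda>i. (bs @ bs') ! i) L = map_literal (\<lambda>i. bs ! i) L"
    using L assms(2) by (auto intro!: map_literal_cong simp: nth_append)
  ultimately show "val \<pi>A (map_literal (\<lambda>i. as ! i) L) \<le> val \<pi>B (map_literal (\<lambda>i. bs ! i) L)"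
    by simp
qed

text \<open>\<open>back_forth\<close> tests \<open>final_win\<close> only after the last round,
  whereas an atomic formula may be met with rounds to spare. An element of the first universe allows
  one more round, whose outcome is cut back to the prefix; with both universes empty the step clause
  would hold vacuously.\<close>

lemma back_forth_final_win:
  assumes "universe \<pi>A \<noteq> {}"
  shows "back_forth \<tau> \<pi>A \<pi>B m as bs \<Longrightarrow> length as = length bs \<Longrightarrow> final_win \<tau> \<pi>A as \<pi>B bs"
proof (induction m arbitrary: as bs)
  case (Suc m)
  then obtain a b where "back_forth \<tau> \<pi>A \<pi>B m (as @ [a]) (bs @ [b])"
    using assms by fastforce
  then have "final_win \<tau> \<pi>A (as @ [a]) \<pi>B (bs @ [b])"
    using Suc by simp
  then show ?case using Suc.prems(2) by (rule final_win_prefix)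
qed simp

text \<open>Entering a quantifier on \<open>x\<close> redirects \<open>x\<close> to the appended
  entry, at index \<open>length as\<close>. The old value of \<open>x\<close> is shadowed, so the
  hypothesis leaves \<open>x\<close> out, in accordance with the free variables of a quantified
  formula.\<close>

lemma positions_extend:
  assumes "length as = length bs"
    and "\<forall>y\<in>V - {x}. \<rho> y < length as \<and> s y = as ! \<rho> y \<and> t y = bs ! \<rho> y"
  shows "\<forall>y\<in>V. (\<rho>(x := length as)) y < length (as @ [a]) \<and>
    (s(x := a)) y = (as @ [a]) ! (\<rho>(x := length as)) y \<and>
    (t(x := b)) y = (bs @ [b]) ! (\<rho>(x := length as)) y"
  using assms by (auto simp: nth_append less_SucI)

text \<open>A formula may rebind variables and use indices far above the length of the tuples; \<open>\<rho>\<close>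
  records at which position of the tuples the current value of each variable stands.\<close>

lemma back_forth_preserves:
  assumes "universe \<pi>A \<noteq> {}"
    and "back_forth \<tau> \<pi>A \<pi>B m as bs" and "length as = length bs"
    and "formula_over \<tau> \<phi>" and "quantifier_rank \<phi> \<le> m"
    and "\<forall>x\<in>free_vars \<phi>. \<rho> x < length as \<and> s x = as ! \<rho> x \<and> t x = bs ! \<rho> x"
    and "eval \<pi>A s \<phi>"
  shows "eval \<pi>B t \<phi>"
  using assms(2-)
proof (induction \<phi> arbitrary: m as bs s t \<rho>)
  case (Eq x y)
  have "final_win \<tau> \<pi>A as \<pi>B bs" by (rule back_forth_final_win[OF assms(1)]; fact)
  with Eq show ?case by (auto simp: final_win_def)
next
  case (Neq x y)
  have "final_win \<tau> \<pi>A as \<pi>B bs" by (rule back_forth_final_win[OF assms(1)]; fact)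
  with Neq show ?case by (auto simp: final_win_def)
next
  case (Lit L)
  have win: "final_win \<tau> \<pi>A as \<pi>B bs" by (rule back_forth_final_win[OF assms(1)]; fact)
  \<comment> \<open>\<open>\<rho>\<close> turns the variables of \<open>L\<close> into positions,
    which makes \<open>map_literal \<rho> L\<close> a literal that \<open>final_win\<close>
    compares.\<close>
  have "map_literal s L = map_literal (\<lambda>i. as ! i) (map_literal \<rho> L)"
    and "map_literal t L = map_literal (\<lambda>i. bs ! i) (map_literal \<rho> L)"
    using Lit.prems by (auto simp: literal.map_comp intro!: map_literal_cong)
  moreover have "literal_over \<tau> (map_literal \<rho> L)" and "lit_args (map_literal \<rho> L) \<subseteq> {..<length as}"
    using Lit.prems by (auto simp: literal_over_map literal.set_map)
  ultimately show ?case using win Lit.prems by (auto simp: final_win_def)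
next
  case (Or \<phi> \<psi>)
  have "eval \<pi>A s \<phi> \<Longrightarrow> eval \<pi>B t \<phi>" using Or.prems by (intro Or.IH(1)[of m as bs \<rho> s t]) auto
  moreover have "eval \<pi>A s \<psi> \<Longrightarrow> eval \<pi>B t \<psi>"
    using Or.prems by (intro Or.IH(2)[of m as bs \<rho> s t]) auto
  ultimately show ?case using Or.prems by auto
next
  case (And \<phi> \<psi>)
  have "eval \<pi>B t \<phi>" using And.prems by (intro And.IH(1)[of m as bs \<rho> s t]) auto
  moreover have "eval \<pi>B t \<psi>" using And.prems by (intro And.IH(2)[of m as bs \<rho> s t]) auto
  ultimately show ?case by simp
next
  case (Ex x \<phi>)
  \<comment> \<open>The rank bound guarantees a round to spend on the quantifier.\<close>
  then obtain m' where m: "m = Suc m'" by (cases m) auto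
  from Ex.prems obtain a where a: "a \<in> universe \<pi>A" "eval \<pi>A (s(x := a)) \<phi>" by auto
  then obtain b where b: "b \<in> universe \<pi>B" "back_forth \<tau> \<pi>A \<pi>B m' (as @ [a]) (bs @ [b])"
    using Ex.prems m by auto
  have "eval \<pi>B (t(x := b)) \<phi>"
    by (rule Ex.IH[OF b(2) _ _ _ positions_extend a(2)])
      (use Ex.prems m in auto)
  then show ?case using b(1) by auto
next
  case (All x \<phi>)
  then obtain m' where m: "m = Suc m'" by (cases m) auto
  have "eval \<pi>B (t(x := b)) \<phi>" if "b \<in> universe \<pi>B" for b
  proof -
    \<comment> \<open>Spoiler plays \<open>b\<close> in the second universe; the instance at the
      answer \<open>a\<close> is true in \<open>\<pi>A\<close> and is carried over to
      \<open>b\<close>.\<close>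
    from that obtain a where a: "a \<in> universe \<pi>A" "back_forth \<tau> \<pi>A \<pi>B m' (as @ [a]) (bs @ [b])"
      using All.prems m by auto
    have "eval \<pi>A (s(x := a)) \<phi>" using All.prems a(1) by simp
    then show ?thesis
      by (rule All.IH[OF a(2) _ _ _ positions_extend, rotated -1]) (use All.prems m in auto)
  qed
  then show ?case by simp
qed auto

lemma back_forth_imp_preceq:
  assumes "universe \<pi>A \<noteq> {}" and "length as = length bs" and "back_forth \<tau> \<pi>A \<pi>B m as bs"
  shows "preceq \<tau> m \<pi>A as \<pi>B bs"
  unfolding preceq_def eval_at_def
proof (intro allI impI le_boolI)
  fix \<phi> assume "formula_over \<tau> \<phi> \<and> free_vars \<phi> \<subseteq> {..<length as} \<and> quantifier_rank \<phi> \<le> m"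
    and "eval \<pi>A (\<lambda>i. as ! i) \<phi>"
  then show "eval \<pi>B (\<lambda>i. bs ! i) \<phi>"
    \<comment> \<open>\<open>eval_at\<close> gives variable \<open>i\<close> the entry at position
      \<open>i\<close>, so the positions are the identity.\<close>
    by (intro back_forth_preserves[OF assms(1,3,2), where \<rho> = id and s = "\<lambda>i. as ! i"]) auto
qed

section \<open>Characteristic formulae define the back-and-forth relation\<close>

text \<open>The clauses of \<open>char_formula\<close> and \<open>back_forth\<close> match one by
  one. An arbitrary assignment \<open>t\<close> stands in for the second tuple because quantifiers
  update assignments, not lists.\<close>

lemma eval_char_formula_iff:
  assumes "finite (dom \<tau>)"
  shows "eval \<pi>B t (char_formula \<tau> \<pi>A m as) \<longleftrightarrow>
    back_forth \<tau> \<pi>A \<pi>B m as (map t [0..<length as])"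
proof (induction m arbitrary: t as)
  case 0
  have "eval \<pi>B t (eq_type as) \<longleftrightarrow>
      (\<forall>i<length as. \<forall>j<length as. as ! i = as ! j \<longleftrightarrow> t i = t j)"
    unfolding eq_type_def eval_Conj[OF finite_eqs] ball_Un
    by (simp add: imp_ex imp_conjL) blast
  moreover have "map_literal t L = map_literal (\<lambda>i. map t [0..<length as] ! i) L"
    if "lit_args L \<subseteq> {..<length as}" for L
    using that by (intro map_literal_cong) auto
  \<comment> \<open>A literal that is false in \<open>\<pi>A\<close> imposes nothing in the order on
    truth values, so listing the true ones captures the one-sided comparison.\<close>
  ultimately show ?case
    by (auto simp: final_win_def eval_Conj[OF finite_Lits[OF assms]])
next
  case (Suc m)
  \<comment> \<open>Updating at index \<open>length as\<close> keeps the entries below it, so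
    reading off the tuple appends \<open>b\<close>.\<close>
  have "eval \<pi>B (t(length as := b)) (char_formula \<tau> \<pi>A m (as @ [a])) \<longleftrightarrow>
      back_forth \<tau> \<pi>A \<pi>B m (as @ [a]) (map t [0..<length as] @ [b])" for a b
    unfolding Suc.IH using map_cong[OF refl, of "[0..<length as]" "t(length as := b)" t] by simp
  then show ?case
    unfolding char_formula.simps eval.simps back_forth.simps
      eval_Conj[OF finite_char_formulas(2)[OF assms]] eval_Disj[OF finite_char_formulas(1)[OF assms]]
    by (simp add: setcompr_eq_image)
qed

lemma eval_at_char_formula_iff:
  assumes "finite (dom \<tau>)" and "length as = length bs"
  shows "eval_at \<pi>B (char_formula \<tau> \<pi>A m as) bs \<longleftrightarrow> back_forth \<tau> \<pi>A \<pi>B m as bs"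
  unfolding eval_at_def eval_char_formula_iff[OF assms(1)] assms(2) map_nth ..

section \<open>Strategies and the recursion of the game\<close>

lemma play_Nil: "play f g [] = []"
  by (simp add: play_def)

text \<open>After the first move \<open>x\<close> every history begins with \<open>x\<close>; the
  later rounds are thus a play of the strategy that prefixes \<open>x\<close> to its
  history.\<close>

lemma play_Cons:
  "play f g (x # ms) =
     (case x of Inl a \<Rightarrow> (a, f [] a) | Inr b \<Rightarrow> (g [] b, b)) #
     play (\<lambda>h. f (x # h)) (\<lambda>h. g (x # h)) ms"
  unfolding play_def length_Cons upt_conv_Cons[OF zero_less_Suc] map_Suc_upt[symmetric]
  by (simp add: comp_def cong: sum.case_cong)

lemma winning_strategy_Suc_iff:
  fixes \<pi>A :: "('r, 'a) interp" and \<pi>B :: "('r, 'b) interp"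
  assumes "universe \<pi>A \<noteq> {}"
  shows "winning_strategy \<tau> (Suc m) \<pi>A as \<pi>B bs f g \<longleftrightarrow>
    (\<forall>a\<in>universe \<pi>A. f [] a \<in> universe \<pi>B \<and> winning_strategy \<tau> m \<pi>A (as @ [a]) \<pi>B (bs @ [f [] a])
       (\<lambda>h. f (Inl a # h)) (\<lambda>h. g (Inl a # h))) \<and>
    (\<forall>b\<in>universe \<pi>B. g [] b \<in> universe \<pi>A \<and> winning_strategy \<tau> m \<pi>A (as @ [g [] b]) \<pi>B (bs @ [b])
       (\<lambda>h. f (Inr b # h)) (\<lambda>h. g (Inr b # h)))"
    (is "?L \<longleftrightarrow> ?A \<and> ?B")
proof
  \<comment> \<open>A winning strategy is required to answer inside the universes only along
    complete plays. Legality of the first answer therefore needs some continuation of length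
    \<open>m\<close>; repeating \<open>a0\<close> supplies one.\<close>
  obtain a0 where "a0 \<in> universe \<pi>A" using assms by blast
  then have rest: "\<exists>ms :: ('a + 'b) list. length ms = m \<and> set ms \<subseteq> universe \<pi>A <+> universe \<pi>B"
    by (intro exI[of _ "replicate m (Inl a0)"]) auto
  assume L: ?L
  have play: "set (play f g (x # ms)) \<subseteq> universe \<pi>A \<times> universe \<pi>B \<and>
      final_win \<tau> \<pi>A (as @ map fst (play f g (x # ms))) \<pi>B (bs @ map snd (play f g (x # ms)))"
    if "length ms = m" "set ms \<subseteq> universe \<pi>A <+> universe \<pi>B" "x \<in> universe \<pi>A <+> universe \<pi>B"
    for x ms
    using that L unfolding winning_strategy_def by (auto dest!: spec[of _ "x # ms"])
  show "?A \<and> ?B"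
  proof (intro conjI ballI)
    fix a assume a: "a \<in> universe \<pi>A"
    show "f [] a \<in> universe \<pi>B"
      using rest play[of _ "Inl a"] a by (auto simp: play_Cons)
    show "winning_strategy \<tau> m \<pi>A (as @ [a]) \<pi>B (bs @ [f [] a])
       (\<lambda>h. f (Inl a # h)) (\<lambda>h. g (Inl a # h))"
      unfolding winning_strategy_def using play[of _ "Inl a"] a by (auto simp: play_Cons)
  next
    fix b assume b: "b \<in> universe \<pi>B"
    show "g [] b \<in> universe \<pi>A"
      using rest play[of _ "Inr b"] b by (auto simp: play_Cons)
    show "winning_strategy \<tau> m \<pi>A (as @ [g [] b]) \<pi>B (bs @ [b])
       (\<lambda>h. f (Inr b # h)) (\<lambda>h. g (Inr b # h))"
      unfolding winning_strategy_def using play[of _ "Inr b"] b by (auto simp: play_Cons)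
  qed
next
  assume AB: "?A \<and> ?B"
  show ?L
    unfolding winning_strategy_def
  proof (intro allI impI)
    fix ms :: "('a + 'b) list"
    assume "length ms = Suc m \<and> set ms \<subseteq> universe \<pi>A <+> universe \<pi>B"
    then obtain x ms' where ms: "ms = x # ms'" and x: "x \<in> universe \<pi>A <+> universe \<pi>B"
      and ms': "length ms' = m \<and> set ms' \<subseteq> universe \<pi>A <+> universe \<pi>B"
      by (cases ms) auto
    from x show "set (play f g ms) \<subseteq> universe \<pi>A \<times> universe \<pi>B \<and>
      final_win \<tau> \<pi>A (as @ map fst (play f g ms)) \<pi>B (bs @ map snd (play f g ms))"
    proof
      fix a assume "a \<in> universe \<pi>A" and x: "x = Inl a"
      with AB have "f [] a \<in> universe \<pi>B" and "winning_strategy \<tau> m \<pi>A (as @ [a]) \<pi>B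
          (bs @ [f [] a]) (\<lambda>h. f (Inl a # h)) (\<lambda>h. g (Inl a # h))"
        by blast+
      with ms' \<open>a \<in> universe \<pi>A\<close> show ?thesis
        unfolding winning_strategy_def ms x play_Cons by simp
    next
      fix b assume "b \<in> universe \<pi>B" and x: "x = Inr b"
      with AB have "g [] b \<in> universe \<pi>A" and "winning_strategy \<tau> m \<pi>A (as @ [g [] b]) \<pi>B
          (bs @ [b]) (\<lambda>h. f (Inr b # h)) (\<lambda>h. g (Inr b # h))"
        by blast+
      with ms' \<open>b \<in> universe \<pi>B\<close> show ?thesis
        unfolding winning_strategy_def ms x play_Cons by simp
    qed
  qed
qed

text \<open>Since strategies see the whole history, winning strategies chosen separately after each
  first move can be merged into one.\<close>

lemma duplicator_wins_Suc_iff: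
  fixes \<pi>A :: "('r, 'a) interp" and \<pi>B :: "('r, 'b) interp"
  assumes "universe \<pi>A \<noteq> {}"
  shows "duplicator_wins \<tau> (Suc m) \<pi>A as \<pi>B bs \<longleftrightarrow>
    (\<forall>a\<in>universe \<pi>A. \<exists>b\<in>universe \<pi>B. duplicator_wins \<tau> m \<pi>A (as @ [a]) \<pi>B (bs @ [b])) \<and>
    (\<forall>b\<in>universe \<pi>B. \<exists>a\<in>universe \<pi>A. duplicator_wins \<tau> m \<pi>A (as @ [a]) \<pi>B (bs @ [b]))"
    (is "?L \<longleftrightarrow> ?A \<and> ?B")
proof
  assume ?L
  then show "?A \<and> ?B"
    unfolding duplicator_wins_def winning_strategy_Suc_iff[OF assms] by blast
next
  assume AB: "?A \<and> ?B"
  \<comment> \<open>By choice, \<open>b\<close> answers a first move in the first universe, and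
    \<open>f1\<close>, \<open>g1\<close> give the strategy that follows it; \<open>a\<close>,
    \<open>f2\<close>, \<open>g2\<close> do the same for the second universe.\<close>
  then obtain b f1 g1 where 1: "\<And>a. a \<in> universe \<pi>A \<Longrightarrow> b a \<in> universe \<pi>B \<and>
      winning_strategy \<tau> m \<pi>A (as @ [a]) \<pi>B (bs @ [b a]) (f1 a) (g1 a)"
    unfolding duplicator_wins_def by metis
  from AB obtain a f2 g2 where 2: "\<And>b. b \<in> universe \<pi>B \<Longrightarrow> a b \<in> universe \<pi>A \<and>
      winning_strategy \<tau> m \<pi>A (as @ [a b]) \<pi>B (bs @ [b]) (f2 b) (g2 b)"
    unfolding duplicator_wins_def by metis
  \<comment> \<open>An empty history calls for the first answer; otherwise the first recorded move
    selects the strategy, which sees only the rest of the history.\<close>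
  define f where "f h x = (case h of [] \<Rightarrow> b x | Inl y # h' \<Rightarrow> f1 y h' x | Inr y # h' \<Rightarrow> f2 y h' x)"
    for h x
  define g where "g h x = (case h of [] \<Rightarrow> a x | Inl y # h' \<Rightarrow> g1 y h' x | Inr y # h' \<Rightarrow> g2 y h' x)"
    for h x
  have "f [] = b" "f (Inl y # h) = f1 y h" "f (Inr z # h) = f2 z h"
    and "g [] = a" "g (Inl y # h) = g1 y h" "g (Inr z # h) = g2 z h" for y z h
    by (simp_all add: f_def g_def fun_eq_iff)
  then have "winning_strategy \<tau> (Suc m) \<pi>A as \<pi>B bs f g"
    unfolding winning_strategy_Suc_iff[OF assms] using 1 2 by simp
  then show ?L unfolding duplicator_wins_def by blast
qed

lemma duplicator_wins_iff_back_forth: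
  assumes "universe \<pi>A \<noteq> {}"
  shows "duplicator_wins \<tau> m \<pi>A as \<pi>B bs \<longleftrightarrow> back_forth \<tau> \<pi>A \<pi>B m as bs"
proof (induction m arbitrary: as bs)
  case 0
  show ?case by (simp add: duplicator_wins_def winning_strategy_def play_Nil)
next
  case (Suc m)
  then show ?case by (simp add: duplicator_wins_Suc_iff[OF assms])
qed

theorem theorem5p3:
  fixes \<tau> :: "'r vocabulary"
    and \<pi>A :: "('r, 'a) interp" and \<pi>B :: "('r, 'b) interp"
    and as :: "'a list" and bs :: "'b list" and n m :: nat
  assumes "finite (dom \<tau>)"
    and "universe \<pi>A \<noteq> {}" and "universe \<pi>B \<noteq> {}"
    and "length as = n" and "set as \<subseteq> universe \<pi>A"
    and "length bs = n" and "set bs \<subseteq> universe \<pi>B"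
  shows "(duplicator_wins \<tau> m \<pi>A as \<pi>B bs \<longleftrightarrow> eval_at \<pi>B (char_formula \<tau> \<pi>A m as) bs = True) \<and>
         (eval_at \<pi>B (char_formula \<tau> \<pi>A m as) bs = True \<longleftrightarrow> preceq \<tau> m \<pi>A as \<pi>B bs)"
proof -
  have len: "length as = length bs" using assms by simp
  have "eval_at \<pi>A (char_formula \<tau> \<pi>A m as) as"
    by (simp add: eval_at_char_formula_iff[OF assms(1)] back_forth_refl)
  then have "preceq \<tau> m \<pi>A as \<pi>B bs \<Longrightarrow> eval_at \<pi>B (char_formula \<tau> \<pi>A m as) bs"
    using char_formula_in_formula_class[OF assms(1), of \<pi>A m as]
    unfolding preceq_def formula_class_def by (simp add: le_bool_def)
  \<comment> \<open>Game and characteristic formula are both equivalent to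
    \<open>back_forth\<close>, which implies \<open>preceq\<close>; the implication just shown leads
    back from \<open>preceq\<close> to the formula.\<close>
  then show ?thesis
    using duplicator_wins_iff_back_forth[OF assms(2)] eval_at_char_formula_iff[OF assms(1) len]
      back_forth_imp_preceq[OF assms(2) len] by blast
qed

end
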